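(* Let $V(r) = -M_\mu r^\mu + \frac12 \Lambda_{\mu\nu} r^\mu r^\nu$ be the Higgs potential of a general two-Higgs-doublet model, regarded as a function on the orbit space $LC^+$, where $M_\mu$ is an arbitrary real four-vector and $\Lambda_{\mu\nu}$ is a real symmetric tensor that is positive definite on $LC^+$, i.e. $\Lambda_{\mu\nu} r^\mu r^\nu > 0$ for all $r \in LC^+\setminus\{0\}$. If the set of local minima of $V$ on $LC^+$ is discrete, then $V$ has at most two local minima on $LC^+$.
   Context: Work in $\mathbb{R}^4$ with coordinates $r^\mu = (r_0, r_1, r_2, r_3)$ and Minkowski metric $g = \mathrm{diag}(1,-1,-1,-1)$. The orbit space of the two-Higgs-doublet model (2HDM) is the closed forward lightcone (surface together with interior, including the apex) $LC^+ = \{ r \in \mathbb{R}^4 : r_0 \ge 0,\ r_0^2 - r_1^2 - r_2^2 - r_3^2 \ge 0\}$. In the orbit space the most general 2HDM Higgs potential is $V(r) = -M_\mu r^\mu + \frac12 \Lambda_{\mu\nu} r^\mu r^\nu$. Minima of the potential are points $r\in LC^+$ that are local minima of the restricted function $V|_{LC^+}$; the number of minima is counted in the orbit space, i.e. as the number of such points $r$. *)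

theory Defs
  imports "HOL-Analysis.Analysis"
begin

(* Spacetime indices are the elements 0, 1, 2, 3 of the four-element type 4; the numeral 4
   denotes the same element as 0, so "r $ 0" is the time component r_0. *)

lemma UNIV_index4: "(UNIV :: 4 set) = {0, 1, 2, 3}"
proof (intro equalityI subsetI)
  fix x :: 4
  have "(4 :: 4) = 0"
    by simp
  with exhaust_4 [of x] have "x = 1 \<or> x = 2 \<or> x = 3 \<or> x = 0"
    by (simp only:)
  then show "x \<in> {0, 1, 2, 3}"
    by blast
qed simp

lemma sum_index4:
  fixes f :: "4 \<Rightarrow> 'a::comm_monoid_add"
  shows "(\<Sum>\<mu>\<in>UNIV. f \<mu>) = f 0 + f 1 + f 2 + f 3"
  unfolding UNIV_index4 by (simp add: add.assoc)

definition LC_plus :: "(real ^ 4) set" where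
  "LC_plus = {r. r $ 0 \<ge> 0 \<and> (r $ 0)\<^sup>2 - (r $ 1)\<^sup>2 - (r $ 2)\<^sup>2 - (r $ 3)\<^sup>2 \<ge> 0}"

(* M and L hold the covariant components M_mu, Lambda_{mu nu} and r the contravariant ones r^mu,
   so the contractions are plain sums and the metric signs do not enter. *)

definition quad_form :: "real ^ 4 ^ 4 \<Rightarrow> real ^ 4 \<Rightarrow> real" where
  "quad_form L r = (\<Sum>\<mu>\<in>UNIV. \<Sum>\<nu>\<in>UNIV. L $ \<mu> $ \<nu> * r $ \<mu> * r $ \<nu>)"

definition higgs_potential :: "real ^ 4 \<Rightarrow> real ^ 4 ^ 4 \<Rightarrow> real ^ 4 \<Rightarrow> real" where
  "higgs_potential M L r = - (\<Sum>\<mu>\<in>UNIV. M $ \<mu> * r $ \<mu>) + 1 / 2 * quad_form L r"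

(* Non-strict local minimum of the restriction of f to S, in the subspace topology of S. *)
definition local_min_on :: "('a::topological_space \<Rightarrow> real) \<Rightarrow> 'a set \<Rightarrow> 'a \<Rightarrow> bool" where
  "local_min_on f S x \<longleftrightarrow> x \<in> S \<and> (\<forall>\<^sub>F y in at x within S. f x \<le> f y)"

definition local_minima :: "('a::topological_space \<Rightarrow> real) \<Rightarrow> 'a set \<Rightarrow> 'a set" where
  "local_minima f S = {x. local_min_on f S x}"

end

theory Submission
  imports Defs
begin

text \<open>
  A local minimum at the apex or in the interior of the cone is easily seen to be the only one: in
  the first case \<open>M \<bullet> r \<le> 0\<close> on the cone, whereas \<open>M \<bullet> r = \<Lambda>(r, r) > 0\<close> at every other minimum;
  in the second case \<open>\<Lambda>\<close> is positive semidefinite, and another minimum would give a whole segment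
  of minima. A nonzero minimum \<open>r\<close> on the surface has a Lagrange multiplier \<open>\<mu> \<ge> 0\<close> with
  \<open>(\<Lambda> - \<mu> g) r = M\<close>, and \<open>\<Lambda> - \<mu> g\<close> is positive semidefinite on the \<open>g\<close>-orthogonal complement
  of \<open>r\<close>. Suppose there are three of these with \<open>\<mu>\<^sub>1 \<le> \<mu>\<^sub>2 \<le> \<mu>\<^sub>3\<close>. The second order conditions at
  the first two, tested on vectors in the span of the three points, are polynomial inequalities
  in the \<open>\<mu>\<^sub>i\<close> and the pairwise products \<open>g(r\<^sub>i, r\<^sub>j) > 0\<close>, and a linear combination of the
  two forces \<open>\<mu>\<^sub>1 = \<mu>\<^sub>3\<close>. But if all multipliers agree, then \<open>\<Lambda> - \<mu> g\<close> vanishes on the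
  differences of the points, and the conic in which their plane meets the surface consists of minima.
\<close>

section \<open>Curves as test objects for local minimality and discreteness\<close>

lemma tendsto_at_right_0_lowerbound:
  fixes f :: "real \<Rightarrow> real"
  assumes "(f \<longlongrightarrow> a) (at_right 0)" and "\<forall>\<^sub>F t in at_right 0. 0 \<le> f t"
  shows "0 \<le> a"
  using tendsto_lowerbound [OF assms] by simp

lemma local_min_mem: "local_min_on f S x \<Longrightarrow> x \<in> S"
  by (simp add: local_min_on_def)

lemma local_min_if_global:
  assumes "x \<in> S" and "\<And>y. y \<in> S \<Longrightarrow> f x \<le> f y"
  shows "x \<in> local_minima f S"
  using assms by (auto simp: local_minima_def local_min_on_def eventually_at_topological)

text \<open>\<open>at x within S\<close> excludes \<open>x\<close>, but wherever the curve passes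
  through \<open>x\<close> the inequality holds by reflexivity, so the curve may return to
  \<open>x\<close>.\<close>

lemma local_min_on_curve:
  assumes "local_min_on f S x" and "(\<gamma> \<longlongrightarrow> x) F" and "\<forall>\<^sub>F t in F. \<gamma> t \<in> S"
  shows "\<forall>\<^sub>F t in F. f x \<le> f (\<gamma> t)"
proof -
  obtain U where "open U" "x \<in> U" and U: "\<And>y. y \<in> U \<Longrightarrow> y \<noteq> x \<Longrightarrow> y \<in> S \<Longrightarrow> f x \<le> f y"
    using assms(1) unfolding local_min_on_def eventually_at_topological by blast
  from topological_tendstoD [OF assms(2) this(1,2)] assms(3) show ?thesis
    by eventually_elim (metis U order_refl)
qed

lemma not_discrete_curve:
  fixes \<gamma> :: "'b \<Rightarrow> 'a::topological_space"
  assumes "x \<in> S" and "(\<gamma> \<longlongrightarrow> x) F" and "F \<noteq> bot"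
    and "\<forall>\<^sub>F t in F. \<gamma> t \<in> S" and "\<forall>\<^sub>F t in F. \<gamma> t \<noteq> x"
  shows "\<not> discrete S"
proof
  assume "discrete S"
  then obtain U where "open U" and U: "U \<inter> S = {x}"
    using assms(1) unfolding discrete_def isolated_in_def by blast
  then have "x \<in> U" by blast
  from topological_tendstoD [OF assms(2) \<open>open U\<close> this] assms(4,5)
  have "\<forall>\<^sub>F t in F. False"
    by eventually_elim (use U in blast)
  with assms(3) show False by simp
qed

section \<open>Minkowski product and the pencil \<open>\<Lambda> - \<mu> g\<close>\<close>

definition mink :: "real ^ 4 \<Rightarrow> real ^ 4 \<Rightarrow> real" where
  "mink x y = x $ 0 * y $ 0 - x $ 1 * y $ 1 - x $ 2 * y $ 2 - x $ 3 * y $ 3"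

text \<open>Hessian of the Lagrangian \<open>V - \<mu>/2 * mink r r\<close> for the constraint
  \<open>mink r r = 0\<close> that describes the surface.\<close>

definition pencil :: "real ^ 4 ^ 4 \<Rightarrow> real \<Rightarrow> real ^ 4 \<Rightarrow> real ^ 4 \<Rightarrow> real" where
  "pencil L \<mu> x y = x \<bullet> (L *v y) - \<mu> * mink x y"

lemma bilinear_mink: "bilinear mink"
  by (auto simp: bilinear_def mink_def algebra_simps intro!: linearI)

lemma bilinear_pencil: "bilinear (pencil L \<mu>)"
  by (auto simp: bilinear_def pencil_def mink_def algebra_simps
      intro!: linearI)

lemma mink_commute: "mink x y = mink y x"
  by (simp add: mink_def mult.commute)

lemma inner_matrix_commute:
  fixes L :: "real ^ 'n ^ 'n"
  assumes "transpose L = L"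
  shows "x \<bullet> (L *v y) = y \<bullet> (L *v x)"
  by (metis assms dot_lmul_matrix inner_commute vector_transpose_matrix)

lemma pencil_commute: "transpose L = L \<Longrightarrow> pencil L \<mu> x y = pencil L \<mu> y x"
  unfolding pencil_def by (metis inner_matrix_commute mink_commute)

lemma bounded_bilinear_mink: "bounded_bilinear mink"
  using bilinear_mink bilinear_conv_bounded_bilinear by blast

lemma bounded_bilinear_pencil: "bounded_bilinear (pencil L \<mu>)"
  using bilinear_pencil bilinear_conv_bounded_bilinear by blast

lemmas tendsto_mink = bounded_bilinear.tendsto [OF bounded_bilinear_mink]
lemmas tendsto_pencil = bounded_bilinear.tendsto [OF bounded_bilinear_pencil]

lemmas bilinear_expand = bilinear_ladd bilinear_radd bilinear_lmul bilinear_rmul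
  bilinear_lsub bilinear_rsub bilinear_lneg bilinear_rneg
lemmas mink_expand = bilinear_expand [OF bilinear_mink]
lemmas pencil_expand = bilinear_expand [OF bilinear_pencil]

lemma quad_form_inner: "quad_form L r = r \<bullet> (L *v r)"
  unfolding quad_form_def
  by (simp add: inner_vec_def matrix_vector_mult_def sum_distrib_left algebra_simps)

lemma higgs_potential_inner: "higgs_potential M L r = - (M \<bullet> r) + 1 / 2 * (r \<bullet> (L *v r))"
  unfolding higgs_potential_def quad_form_inner by (simp add: inner_vec_def)

section \<open>Geometry of the forward light cone\<close>

lemma mem_LC_plus_iff: "r \<in> LC_plus \<longleftrightarrow> 0 \<le> r $ 0 \<and> 0 \<le> mink r r"
  by (simp add: LC_plus_def mink_def power2_eq_square)

lemma vec4_eq_iff: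
  fixes x y :: "'a ^ 4"
  shows "x = y \<longleftrightarrow> x $ 0 = y $ 0 \<and> x $ 1 = y $ 1 \<and> x $ 2 = y $ 2 \<and> x $ 3 = y $ 3"
proof -
  have "x = y \<longleftrightarrow> (\<forall>i\<in>UNIV. x $ i = y $ i)" by (simp add: vec_eq_iff)
  then show ?thesis unfolding UNIV_index4 by simp
qed

lemma LC_plus_time_pos:
  assumes "r \<in> LC_plus" "r \<noteq> 0"
  shows "0 < r $ 0"
proof (rule ccontr)
  assume "\<not> ?thesis"
  with assms have r0: "r $ 0 = 0" by (simp add: mem_LC_plus_iff)
  with assms have "(r $ 1)\<^sup>2 + (r $ 2)\<^sup>2 + (r $ 3)\<^sup>2 \<le> 0"
    by (simp add: LC_plus_def)
  then have "r $ 1 = 0 \<and> r $ 2 = 0 \<and> r $ 3 = 0"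
    by (smt (verit) zero_le_power2 zero_less_power2)
  with r0 assms(2) show False by (simp add: vec4_eq_iff)
qed

text \<open>Expansion of the Minkowski square of
  \<open>r $ 0 *\<^sub>R s - s $ 0 *\<^sub>R r\<close>: its time component vanishes, so the square
  is minus a sum of three spatial squares. This gives the sign of \<open>mink r s\<close> on the
  cone without square roots.\<close>

lemma mink_lagrange:
  "2 * (r $ 0 * s $ 0) * mink r s
    = (r $ 0 * s $ 1 - s $ 0 * r $ 1)\<^sup>2 + (r $ 0 * s $ 2 - s $ 0 * r $ 2)\<^sup>2
      + (r $ 0 * s $ 3 - s $ 0 * r $ 3)\<^sup>2 + (s $ 0)\<^sup>2 * mink r r + (r $ 0)\<^sup>2 * mink s s"
  unfolding mink_def by algebra

lemma mink_nonneg: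
  assumes "r \<in> LC_plus" "s \<in> LC_plus"
  shows "0 \<le> mink r s"
proof (cases "r = 0 \<or> s = 0")
  case True
  then show ?thesis by (auto simp: mink_def)
next
  case False
  then have "0 < r $ 0 * s $ 0"
    using assms by (simp add: LC_plus_time_pos)
  moreover have "0 \<le> 2 * (r $ 0 * s $ 0) * mink r s"
    unfolding mink_lagrange using assms by (simp add: mem_LC_plus_iff)
  ultimately show ?thesis by (simp add: zero_le_mult_iff)
qed

text \<open>The three squares in \<open>mink_lagrange\<close> vanish together only if
  \<open>r $ 0 *\<^sub>R s = s $ 0 *\<^sub>R r\<close>.\<close>

lemma mink_pos:
  assumes "r \<in> LC_plus" "s \<in> LC_plus" and "r $ 0 *\<^sub>R s \<noteq> s $ 0 *\<^sub>R r"
  shows "0 < mink r s"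
proof -
  have "0 \<le> mink r r" "0 \<le> mink s s"
    using assms by (auto simp: mem_LC_plus_iff)
  moreover have "r $ 0 * s $ 1 \<noteq> s $ 0 * r $ 1 \<or> r $ 0 * s $ 2 \<noteq> s $ 0 * r $ 2
      \<or> r $ 0 * s $ 3 \<noteq> s $ 0 * r $ 3"
    using assms(3) by (auto simp: vec4_eq_iff)
  ultimately have "0 < 2 * (r $ 0 * s $ 0) * mink r s"
    unfolding mink_lagrange
    by (smt (verit) mult_nonneg_nonneg zero_less_power2 zero_le_power2 eq_iff_diff_eq_0)
  with mink_nonneg [OF assms(1,2)] show ?thesis
    by (metis mult_zero_right order_le_less)
qed

lemma convex_LC_plus: "convex LC_plus"
proof (rule convexI)
  fix r s :: "real ^ 4" and u v :: real
  assume rs: "r \<in> LC_plus" "s \<in> LC_plus" and uv: "0 \<le> u" "0 \<le> v"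
  have "mink (u *\<^sub>R r + v *\<^sub>R s) (u *\<^sub>R r + v *\<^sub>R s)
      = u\<^sup>2 * mink r r + 2 * (u * v * mink r s) + v\<^sup>2 * mink s s"
    by (simp add: mink_expand mink_commute [of s r] power2_eq_square algebra_simps)
  then show "u *\<^sub>R r + v *\<^sub>R s \<in> LC_plus"
    using rs uv mink_nonneg [OF rs] by (simp add: mem_LC_plus_iff)
qed

lemma LC_plus_scale: "r \<in> LC_plus \<Longrightarrow> 0 \<le> c \<Longrightarrow> c *\<^sub>R r \<in> LC_plus"
  by (simp add: mem_LC_plus_iff mink_expand)

lemma eventually_interior:
  assumes "0 < r $ 0" and "0 < mink r r" and "(\<gamma> \<longlongrightarrow> r) F"
  shows "\<forall>\<^sub>F t in F. \<gamma> t \<in> LC_plus"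
  using order_tendstoD(1) [OF tendsto_vec_nth [OF assms(3)] assms(1)]
    order_tendstoD(1) [OF tendsto_mink [OF assms(3) assms(3)] assms(2)]
  by eventually_elim (simp add: mem_LC_plus_iff)

section \<open>Exact expansions of the potential\<close>

text \<open>The second assumption makes \<open>r\<close> a critical point of the Lagrangian, whose
  second order expansion about \<open>r\<close> is exact and has no linear term; the
  \<open>mink\<close> difference converts back to \<open>V\<close>.\<close>

lemma higgs_potential_diff:
  assumes "transpose L = L" and "\<And>v. pencil L \<mu> r v = M \<bullet> v"
  shows "higgs_potential M L s - higgs_potential M L r
      = (pencil L \<mu> (s - r) (s - r) + \<mu> * (mink s s - mink r r)) / 2"
proof -
  have "M \<bullet> (s - r) = pencil L \<mu> r (s - r)" by (simp add: assms)
  then show ?thesis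
    unfolding higgs_potential_inner
    by (simp add: pencil_def mink_expand mink_commute [of s r] inner_matrix_commute [OF assms(1), of s r]
        matrix_vector_mult_diff_distrib inner_diff field_simps)
qed

lemma higgs_potential_line:
  assumes "transpose L = L"
  shows "higgs_potential M L (r + t *\<^sub>R v)
    = higgs_potential M L r + t * ((L *v r - M) \<bullet> v + t / 2 * (v \<bullet> (L *v v)))"
  unfolding higgs_potential_inner
  using inner_matrix_commute [OF assms, of r v]
  by (simp add: algebra_simps inner_commute [of "L *v r"])

section \<open>First and second order conditions at a local minimum\<close>

context
  fixes M :: "real ^ 4" and L :: "real ^ 4 ^ 4"
  assumes sym: "transpose L = L"
begin

lemma local_min_line:
  assumes "local_min_on (higgs_potential M L) LC_plus r"
    and "\<forall>\<^sub>F t in at_right 0. r + t *\<^sub>R v \<in> LC_plus"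
  shows "\<forall>\<^sub>F t in at_right 0. 0 \<le> (L *v r - M) \<bullet> v + t / 2 * (v \<bullet> (L *v v))"
proof -
  have "((\<lambda>t. r + t *\<^sub>R v) \<longlongrightarrow> r) (at_right 0)"
    by (auto intro!: tendsto_eq_intros)
  from local_min_on_curve [OF assms(1) this assms(2)] eventually_at_right_less [of 0]
  show ?thesis
    by eventually_elim (simp add: higgs_potential_line [OF sym] zero_le_mult_iff)
qed

lemma local_min_first_order:
  assumes "local_min_on (higgs_potential M L) LC_plus r"
    and "\<forall>\<^sub>F t in at_right 0. r + t *\<^sub>R v \<in> LC_plus"
  shows "0 \<le> (L *v r - M) \<bullet> v"
  by (rule tendsto_at_right_0_lowerbound [OF _ local_min_line [OF assms]])
    (auto intro!: tendsto_eq_intros)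

lemma local_min_second_order_line:
  assumes "local_min_on (higgs_potential M L) LC_plus r"
    and "\<forall>\<^sub>F t in at_right 0. r + t *\<^sub>R v \<in> LC_plus"
    and "(L *v r - M) \<bullet> v = 0"
  shows "0 \<le> v \<bullet> (L *v v)"
proof -
  from local_min_line [OF assms(1,2)] eventually_at_right_less [of 0]
  have "\<forall>\<^sub>F t::real in at_right 0. 0 \<le> v \<bullet> (L *v v)"
    by eventually_elim (simp add: assms(3) zero_le_mult_iff)
  then show ?thesis by simp
qed

text \<open>On a cone both \<open>r\<close> and \<open>- r\<close> are feasible directions at
  \<open>r\<close>, so the derivative along \<open>r\<close> vanishes.\<close>

lemma local_min_radial:
  assumes "local_min_on (higgs_potential M L) LC_plus r"
  shows "M \<bullet> r = quad_form L r"
proof -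
  have r: "r \<in> LC_plus" using assms by (rule local_min_mem)
  have "\<forall>\<^sub>F t in at_right (0::real). t < 1"
    by (rule eventually_at_right_real [of 0 1, THEN eventually_mono]) auto
  then have "\<forall>\<^sub>F t in at_right 0. r + t *\<^sub>R (- r) \<in> LC_plus"
    by eventually_elim (use LC_plus_scale [OF r, of "1 - _"] in \<open>simp add: algebra_simps\<close>)
  moreover have "\<forall>\<^sub>F t in at_right 0. r + t *\<^sub>R r \<in> LC_plus"
    using eventually_at_right_less [of 0]
    by eventually_elim (use LC_plus_scale [OF r, of "1 + _"] in \<open>simp add: algebra_simps\<close>)
  ultimately have "(L *v r - M) \<bullet> r = 0"
    using local_min_first_order [OF assms, of r] local_min_first_order [OF assms, of "- r"] by simp
  then show ?thesis
    by (simp add: quad_form_inner inner_diff inner_commute)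
qed

lemma local_min_apex:
  assumes "local_min_on (higgs_potential M L) LC_plus 0" and "r \<in> LC_plus"
  shows "M \<bullet> r \<le> 0"
proof -
  have "\<forall>\<^sub>F t in at_right 0. 0 + t *\<^sub>R r \<in> LC_plus"
    using eventually_at_right_less [of 0]
    by eventually_elim (simp add: LC_plus_scale assms(2))
  from local_min_first_order [OF assms(1) this] show ?thesis by simp
qed

lemma local_min_interior:
  assumes "local_min_on (higgs_potential M L) LC_plus r" and "0 < r $ 0" and "0 < mink r r"
  shows "L *v r = M" and "0 \<le> v \<bullet> (L *v v)"
proof -
  have ev: "\<forall>\<^sub>F t in at_right 0. r + t *\<^sub>R v \<in> LC_plus" for v
    by (rule eventually_interior [OF assms(2,3)]) (auto intro!: tendsto_eq_intros)
  \<comment> \<open>In the interior steepest descent is a feasible direction, which forces the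
    gradient to vanish.\<close>
  have "0 \<le> (L *v r - M) \<bullet> (- (L *v r - M))"
    by (rule local_min_first_order [OF assms(1) ev])
  then show *: "L *v r = M"
    using inner_ge_zero [of "L *v r - M"] inner_eq_zero_iff [of "L *v r - M"]
    unfolding inner_minus_right by (metis antisym eq_iff_diff_eq_0 neg_0_le_iff_le)
  show "0 \<le> v \<bullet> (L *v v)"
    by (rule local_min_second_order_line [OF assms(1) ev]) (simp add: *)
qed

text \<open>Karush-Kuhn-Tucker: the gradient \<open>G\<close> is nonnegative on the half space
  \<open>0 < mink r v\<close> of inward directions, hence a nonnegative multiple of
  \<open>mink r\<close>. Curvature is tested along curves inside the surface, where the constraint
  term of the Lagrangian is constant.\<close>

lemma local_min_boundary:
  assumes min: "local_min_on (higgs_potential M L) LC_plus r" and "0 < r $ 0" and null: "mink r r = 0"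
  obtains \<mu> where "0 \<le> \<mu>" and "\<And>v. pencil L \<mu> r v = M \<bullet> v"
    and "\<And>w. mink r w = 0 \<Longrightarrow> 0 \<le> pencil L \<mu> w w"
proof -
  define G where "G = L *v r - M"
  have time: "\<forall>\<^sub>F t in F. 0 < \<gamma> t $ 0" if "(\<gamma> \<longlongrightarrow> r) F" for \<gamma> and F :: "real filter"
    using order_tendstoD(1) [OF tendsto_vec_nth [OF that] assms(2)] .
  have inward: "0 \<le> G \<bullet> v" if v: "0 < mink r v" for v
    unfolding G_def
  proof (rule local_min_first_order [OF min])
    have "((\<lambda>t. r + t *\<^sub>R v) \<longlongrightarrow> r) (at_right 0)"
      by (auto intro!: tendsto_eq_intros)
    note 1 = time [OF this]
    have "((\<lambda>t. 2 * mink r v + t * mink v v) \<longlongrightarrow> 2 * mink r v) (at_right 0)"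
      by (auto intro!: tendsto_eq_intros)
    from order_tendstoD(1) [OF this, of 0] v
    have "\<forall>\<^sub>F t in at_right 0. 0 < 2 * mink r v + t * mink v v" by simp
    with 1 eventually_at_right_less [of 0] show "\<forall>\<^sub>F t in at_right 0. r + t *\<^sub>R v \<in> LC_plus"
    proof eventually_elim
      case (elim t)
      have "mink (r + t *\<^sub>R v) (r + t *\<^sub>R v) = t * (2 * mink r v + t * mink v v)"
        by (simp add: mink_expand null mink_commute [of v r] algebra_simps)
      with elim show ?case by (simp add: mem_LC_plus_iff)
    qed
  qed
  define e :: "real ^ 4" where "e = axis 0 1"
  have e: "mink r e = r $ 0"
    by (simp add: mink_def e_def axis_def)
  \<comment> \<open>A tangent \<open>w\<close> is the limit of the inward directions
    \<open>w + t *\<^sub>R e\<close>. Since \<open>- w\<close> is tangent too, equality will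
    follow.\<close>
  have tangent_le: "0 \<le> G \<bullet> w" if w: "mink r w = 0" for w
  proof (rule tendsto_at_right_0_lowerbound)
    show "((\<lambda>t. G \<bullet> (w + t *\<^sub>R e)) \<longlongrightarrow> G \<bullet> w) (at_right 0)"
      by (auto intro!: tendsto_eq_intros)
    show "\<forall>\<^sub>F t in at_right 0. 0 \<le> G \<bullet> (w + t *\<^sub>R e)"
      using eventually_at_right_less [of 0]
      by eventually_elim (rule inward, simp add: mink_expand w e assms(2))
  qed
  have tangent: "G \<bullet> w = 0" if "mink r w = 0" for w
    using tangent_le [OF that] tangent_le [of "- w"] that by (simp add: mink_expand)
  \<comment> \<open>Testing \<open>G \<bullet> v = \<mu> * mink r v\<close> on \<open>v = e\<close>
    leaves only this value.\<close>
  define \<mu> where "\<mu> = (G \<bullet> e) / r $ 0"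
  have "0 \<le> \<mu>"
    using inward [of e] assms(2) by (simp add: \<mu>_def e)
  have G: "G \<bullet> v = \<mu> * mink r v" for v
  proof -
    have "G \<bullet> (v - (mink r v / r $ 0) *\<^sub>R e) = 0"
      using assms(2) by (intro tangent) (simp add: mink_expand e)
    then show ?thesis by (simp add: \<mu>_def inner_diff)
  qed
  have crit: "pencil L \<mu> r v = M \<bullet> v" for v
    using G [of v] inner_matrix_commute [OF sym, of r v]
    by (simp add: pencil_def G_def inner_diff inner_commute [of "L *v r"])
  have "0 \<le> pencil L \<mu> w w" if w: "mink r w = 0" for w
  proof -
    \<comment> \<open>Moving along \<open>w\<close> leaves the surface; a second order correction along the null vector \<open>n\<close>,
      the spatial reflection of \<open>r\<close>, leads back to it.\<close>
    define n :: "real ^ 4" where "n = (2 * r $ 0) *\<^sub>R e - r"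
    have n: "mink n n = 0" "mink r n = 2 * (r $ 0)\<^sup>2"
      by (simp_all add: n_def mink_expand e mink_commute [of e r] null power2_eq_square)
        (simp add: mink_def e_def axis_def)
    \<comment> \<open>Because \<open>n\<close> and \<open>r\<close> are null and
      \<open>mink r w = 0\<close>, nullness of \<open>r + t *\<^sub>R (w + c *\<^sub>R n)\<close>
      is, after division by \<open>t\<close>, a linear equation in \<open>c\<close>; this is its
      solution.\<close>
    define c where "c t = - t * mink w w / (2 * (mink r n + t * mink w n))" for t
    define x where "x t = w + c t *\<^sub>R n" for t
    have "mink r n > 0" using n assms(2) by simp
    then have "(c \<longlongrightarrow> 0) (at_right 0)"
      unfolding c_def by (auto intro!: tendsto_eq_intros)
    then have x: "(x \<longlongrightarrow> w) (at_right 0)"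
      unfolding x_def by (auto intro!: tendsto_eq_intros)
    have lim: "((\<lambda>t. r + t *\<^sub>R x t) \<longlongrightarrow> r) (at_right 0)"
      by (rule tendsto_eq_intros x refl | simp)+
    have "((\<lambda>t. mink r n + t * mink w n) \<longlongrightarrow> mink r n) (at_right 0)"
      by (auto intro!: tendsto_eq_intros)
    from order_tendstoD(1) [OF this \<open>mink r n > 0\<close>]
    have "\<forall>\<^sub>F t in at_right 0. mink (r + t *\<^sub>R x t) (r + t *\<^sub>R x t) = 0"
    proof eventually_elim
      case (elim t)
      have "2 * (- t * mink w w / (2 * d)) * d = - t * mink w w" if "0 < d" for d
        using that by simp
      from this [OF elim] have "2 * c t * (mink r n + t * mink w n) = - t * mink w w"
        unfolding c_def .
      moreover have "mink (r + t *\<^sub>R x t) (r + t *\<^sub>R x t)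
          = t * (t * mink w w + 2 * c t * (mink r n + t * mink w n))"
        by (simp add: x_def mink_expand w null n(1) mink_commute [of w r] mink_commute [of n r]
            mink_commute [of n w] algebra_simps)
      ultimately show ?case by simp
    qed
    note null_curve = this
    with time [OF lim] have "\<forall>\<^sub>F t in at_right 0. r + t *\<^sub>R x t \<in> LC_plus"
      by eventually_elim (simp add: mem_LC_plus_iff)
    \<comment> \<open>Both \<open>r\<close> and the curve point are null, so the increment of
      \<open>V\<close> is exactly \<open>t^2/2\<close> times the pencil at
      \<open>x t\<close>.\<close>
    from local_min_on_curve [OF min lim this] null_curve eventually_at_right_less [of 0]
    have "\<forall>\<^sub>F t in at_right 0. 0 \<le> pencil L \<mu> (x t) (x t)"
    proof eventually_elim
      case (elim t)
      then have "0 \<le> t * (t * pencil L \<mu> (x t) (x t))"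
        using higgs_potential_diff [OF sym crit, of "r + t *\<^sub>R x t"]
        by (simp add: null pencil_expand)
      with elim show ?case by (simp add: zero_le_mult_iff)
    qed
    with tendsto_pencil [OF x x] show ?thesis
      by (rule tendsto_at_right_0_lowerbound)
  qed
  with that \<open>0 \<le> \<mu>\<close> crit show thesis by blast
qed


section \<open>Uniqueness of an interior minimum\<close>

lemma local_min_unique_if_interior:
  assumes "discrete (local_minima (higgs_potential M L) LC_plus)"
    and r: "local_min_on (higgs_potential M L) LC_plus r" "0 < r $ 0" "0 < mink r r"
    and s: "local_min_on (higgs_potential M L) LC_plus s"
  shows "s = r"
proof (rule ccontr)
  assume "s \<noteq> r"
  note Lr = local_min_interior [OF r]
  have diff: "higgs_potential M L x - higgs_potential M L r = ((x - r) \<bullet> (L *v (x - r))) / 2" for x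
    using higgs_potential_diff [OF sym, of 0 r M x] inner_matrix_commute [OF sym, of r] Lr(1)
    by (simp add: pencil_def inner_commute)
  define d where "d = s - r"
  \<comment> \<open>The segment from \<open>s\<close> at \<open>t = 0\<close> to \<open>r\<close> at
    \<open>t = 1\<close>.\<close>
  define \<gamma> where "\<gamma> t = r + (1 - t) *\<^sub>R d" for t
  have lim: "(\<gamma> \<longlongrightarrow> s) (at_right 0)"
    unfolding \<gamma>_def by (auto simp: d_def intro!: tendsto_eq_intros)
  have less_1: "\<forall>\<^sub>F t in at_right (0::real). t < 1"
    by (rule eventually_at_right_real [of 0 1, THEN eventually_mono]) auto
  have in_LC: "\<forall>\<^sub>F t in at_right 0. \<gamma> t \<in> LC_plus"
    using less_1 eventually_at_right_less [of 0]
  proof eventually_elim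
    case (elim t)
    then have "t *\<^sub>R r + (1 - t) *\<^sub>R s \<in> LC_plus"
      by (intro convexD [OF convex_LC_plus] local_min_mem [OF r(1)] local_min_mem [OF s]) auto
    then show ?case by (simp add: \<gamma>_def d_def algebra_simps)
  qed
  have \<gamma>_diff: "higgs_potential M L (\<gamma> t) - higgs_potential M L r
      = (1 - t)\<^sup>2 * (d \<bullet> (L *v d)) / 2" for t
    unfolding diff by (simp add: \<gamma>_def matrix_vector_mult_scaleR power2_eq_square)
  \<comment> \<open>Moving from \<open>s\<close> towards \<open>r\<close> scales the excess of
    \<open>V\<close> over its value at \<open>r\<close> by \<open>(1 - t)^2 < 1\<close>, so
    minimality at \<open>s\<close> rules out a positive excess.\<close>
  have "\<forall>\<^sub>F t::real in at_right 0. d \<bullet> (L *v d) = 0"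
    using local_min_on_curve [OF s lim in_LC] less_1 eventually_at_right_less [of 0]
  proof eventually_elim
    case (elim t)
    then have "(1 - (1 - t)\<^sup>2) * (d \<bullet> (L *v d)) \<le> 0"
      using \<gamma>_diff [of t] \<gamma>_diff [of 0] by (simp add: \<gamma>_def d_def left_diff_distrib)
    moreover have "0 < 1 - (1 - t)\<^sup>2"
      using elim abs_square_less_1 [of "1 - t"] by simp
    ultimately have "d \<bullet> (L *v d) \<le> 0"
      by (metis mult_le_0_iff not_le)
    with Lr(2) [of d] show ?case by simp
  qed
  then have d0: "d \<bullet> (L *v d) = 0" by simp
  have "\<forall>\<^sub>F t in at_right 0. \<gamma> t \<in> local_minima (higgs_potential M L) LC_plus"
    using in_LC
  proof eventually_elim
    case (elim t)
    show ?case
    proof (rule local_min_if_global [OF elim])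
      show "higgs_potential M L (\<gamma> t) \<le> higgs_potential M L x" for x
        using \<gamma>_diff [of t] diff [of x] Lr(2) [of "x - r"] by (simp add: d0)
    qed
  qed
  moreover have "\<forall>\<^sub>F t in at_right 0. \<gamma> t \<noteq> s"
    using eventually_at_right_less [of 0]
    by eventually_elim (use \<open>s \<noteq> r\<close> in \<open>auto simp: \<gamma>_def d_def algebra_simps\<close>)
  ultimately have "\<not> discrete (local_minima (higgs_potential M L) LC_plus)"
    using s lim by (intro not_discrete_curve [of s _ \<gamma> "at_right 0"]) (simp_all add: local_minima_def)
  with assms(1) show False by blast
qed

end

section \<open>Three minima on the surface\<close>

text \<open>The argument evaluates the forms only on the span of the three points, hence the
  abstract \<open>B\<close> and \<open>g\<close>; they become \<open>pencil L 0\<close>, the form of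
  \<Lambda>, and \<open>mink\<close>.\<close>

lemma three_critical_points:
  fixes B g :: "'a::real_vector \<Rightarrow> 'a \<Rightarrow> real"
  assumes B: "bilinear B" "\<And>x y. B x y = B y x" and g: "bilinear g" "\<And>x y. g x y = g y x"
    and M: "linear M"
    and null: "g r1 r1 = 0" "g r2 r2 = 0" "g r3 r3 = 0"
    and pos: "0 < g r1 r2" "0 < g r1 r3" "0 < g r2 r3"
    and crit: "\<And>v. B r1 v - \<mu>1 * g r1 v = M v" "\<And>v. B r2 v - \<mu>2 * g r2 v = M v"
      "\<And>v. B r3 v - \<mu>3 * g r3 v = M v"
    and M_pos: "0 < M r1" "0 < M r2" "0 < M r3"
    and snd1: "\<And>w. g r1 w = 0 \<Longrightarrow> 0 \<le> B w w - \<mu>1 * g w w"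
    and snd2: "\<And>w. g r2 w = 0 \<Longrightarrow> 0 \<le> B w w - \<mu>2 * g w w"
    and order: "\<mu>1 \<le> \<mu>2" "\<mu>2 \<le> \<mu>3"
  shows "\<mu>1 = \<mu>3"
proof (rule ccontr)
  assume "\<mu>1 \<noteq> \<mu>3"
  \<comment> \<open>Rescaling the points to the hyperplane \<open>M = 1\<close> expresses all products \<open>B ui uj\<close> through the
    \<open>k\<close>'s, the \<open>q\<close>'s and the multipliers; the symmetry of \<open>B\<close> then determines the differences of
    the \<open>k\<close>'s.\<close>
  define k1 k2 k3 where "k1 = 1 / M r1" and "k2 = 1 / M r2" and "k3 = 1 / M r3"
  define u1 u2 u3 where "u1 = k1 *\<^sub>R r1" and "u2 = k2 *\<^sub>R r2" and "u3 = k3 *\<^sub>R r3"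
  define q12 q13 q23 where "q12 = g u1 u2" and "q13 = g u1 u3" and "q23 = g u2 u3"
  note g_expand = bilinear_expand [OF g(1)] and B_expand = bilinear_expand [OF B(1)]
  have k_pos: "0 < k1" "0 < k2" "0 < k3"
    using M_pos by (simp_all add: k1_def k2_def k3_def)
  have M1: "M u1 = 1" "M u2 = 1" "M u3 = 1"
    using M_pos by (simp_all add: u1_def u2_def u3_def k1_def k2_def k3_def linear_cmul [OF M])
  have q_pos: "0 < q12" "0 < q13" "0 < q23"
    using pos k_pos by (simp_all add: q12_def q13_def q23_def u1_def u2_def u3_def g_expand)
  have gu: "g u1 u1 = 0" "g u2 u2 = 0" "g u3 u3 = 0" "g u1 u2 = q12" "g u2 u1 = q12"
    "g u1 u3 = q13" "g u3 u1 = q13" "g u2 u3 = q23" "g u3 u2 = q23"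
    using g(2) by (simp_all add: q12_def q13_def q23_def u1_def u2_def u3_def g_expand null)
  have Bu: "B u1 v = k1 * M v + \<mu>1 * g u1 v" "B u2 v = k2 * M v + \<mu>2 * g u2 v"
    "B u3 v = k3 * M v + \<mu>3 * g u3 v" for v
    using crit(1-3) [of v, unfolded diff_eq_eq]
    by (simp_all add: u1_def u2_def u3_def g_expand B_expand distrib_left)
  have k12: "k1 - k2 = (\<mu>2 - \<mu>1) * q12" and k13: "k1 - k3 = (\<mu>3 - \<mu>1) * q13"
    and k23: "k2 - k3 = (\<mu>3 - \<mu>2) * q23"
    using B(2) [of u1 u2] B(2) [of u1 u3] B(2) [of u2 u3]
    by (simp_all add: Bu M1 gu algebra_simps)
  \<comment> \<open>Both vectors combine differences of points with \<open>M = 1\<close>, so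
    \<open>M\<close> vanishes on them; the weights make \<open>d1\<close> orthogonal to
    \<open>u1\<close> and \<open>d2\<close> orthogonal to \<open>u2\<close> with respect to
    \<open>g\<close>.\<close>
  define d1 where "d1 = q13 *\<^sub>R (u2 - u1) - q12 *\<^sub>R (u3 - u1)"
  define d2 where "d2 = q23 *\<^sub>R (u1 - u2) - q12 *\<^sub>R (u3 - u2)"
  have "g u1 d1 = 0" "g u2 d2 = 0"
    by (simp_all add: d1_def d2_def g_expand gu)
  then have "g r1 d1 = 0" "g r2 d2 = 0"
    using k_pos by (simp_all add: u1_def u2_def g_expand)
  then have nn: "0 \<le> B d1 d1 - \<mu>1 * g d1 d1" "0 \<le> B d2 d2 - \<mu>2 * g d2 d2"
    using snd1 snd2 by blast+
  have "B d1 d1 - \<mu>1 * g d1 d1 = q13\<^sup>2 * (k2 - k1) + q12\<^sup>2 * (k3 - k1)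
      - 2 * q12 * q13 * (k2 - k1 + (\<mu>2 - \<mu>1) * q23)"
    using k12 k13 k23 by (simp add: d1_def B_expand g_expand gu Bu M1 power2_eq_square) algebra
  \<comment> \<open>Inserting the differences of the \<open>k\<close>'s exposes the positive factor
    \<open>q12 * q13\<close>, which is then cancelled.\<close>
  also have "\<dots> = q12 * q13 * (- (\<mu>2 - \<mu>1) * q13 - (\<mu>3 - \<mu>1) * q12 - 2 * (\<mu>2 - \<mu>1) * (q23 - q12))"
    using k12 k13 by algebra
  finally have C1: "0 \<le> - (\<mu>2 - \<mu>1) * q13 - (\<mu>3 - \<mu>1) * q12 - 2 * (\<mu>2 - \<mu>1) * (q23 - q12)"
    using nn(1) mult_le_cancel_left_pos [OF mult_pos_pos [OF q_pos(1) q_pos(2)], of 0]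
    by (simp only: mult_zero_right)
  have "B d2 d2 - \<mu>2 * g d2 d2 = q23\<^sup>2 * (k1 - k2) + q12\<^sup>2 * (k3 - k2)
      - 2 * q12 * q23 * (k1 - k2 - (\<mu>2 - \<mu>1) * q13)"
    using k12 k13 k23 by (simp add: d2_def B_expand g_expand gu Bu M1 power2_eq_square) algebra
  also have "\<dots> = q12 * q23 * ((\<mu>2 - \<mu>1) * q23 - (\<mu>3 - \<mu>2) * q12 - 2 * (\<mu>2 - \<mu>1) * (q12 - q13))"
    using k12 k23 by algebra
  finally have C2: "0 \<le> (\<mu>2 - \<mu>1) * q23 - (\<mu>3 - \<mu>2) * q12 - 2 * (\<mu>2 - \<mu>1) * (q12 - q13)"
    using nn(2) mult_le_cancel_left_pos [OF mult_pos_pos [OF q_pos(1) q_pos(3)], of 0]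
    by (simp only: mult_zero_right)
  \<comment> \<open>\<open>2 C1 + C2\<close>\<close>
  have "(\<mu>3 - \<mu>2) * q12 + (\<mu>2 - \<mu>1) * q23 \<le> 0"
    using C1 C2 by (simp add: algebra_simps)
  \<comment> \<open>The two gaps between the multipliers are nonnegative and not both zero.\<close>
  moreover have "0 < (\<mu>3 - \<mu>2) * q12 + (\<mu>2 - \<mu>1) * q23"
    using order q_pos \<open>\<mu>1 \<noteq> \<mu>3\<close>
    by (smt (verit) mult_nonneg_nonneg mult_pos_pos)
  ultimately show False by simp
qed

text \<open>With a common multiplier the Lagrangian is convex and critical on the whole affine span
  of the three points. As \<open>0 \<le> \<mu>\<close>, every null point of the cone in that span is
  then a global minimum of \<open>V\<close> on the cone.\<close>

lemma three_equal_multipliers_not_discrete: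
  assumes sym: "transpose L = L" and "0 \<le> \<mu>"
    and LC: "r1 \<in> LC_plus" "0 < r1 $ 0"
    and null: "mink r1 r1 = 0" "mink r2 r2 = 0" "mink r3 r3 = 0"
    and pos: "0 < mink r1 r2" "0 < mink r1 r3" "0 < mink r2 r3"
    and crit: "\<And>v. pencil L \<mu> r1 v = M \<bullet> v" "\<And>v. pencil L \<mu> r2 v = M \<bullet> v"
      "\<And>v. pencil L \<mu> r3 v = M \<bullet> v"
    and snd: "\<And>w. mink r1 w = 0 \<Longrightarrow> 0 \<le> pencil L \<mu> w w"
  shows "\<not> discrete (local_minima (higgs_potential M L) LC_plus)"
proof -
  \<comment> \<open>\<open>r2 - r1\<close> lies in the kernel of the pencil and is transversal to
    the hyperplane \<open>mink r1 w = 0\<close>; subtracting a multiple of it moves \<open>v\<close>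
    into that hyperplane without changing the value.\<close>
  have psd: "0 \<le> pencil L \<mu> v v" for v
  proof -
    define c where "c = mink r1 v / mink r1 r2"
    define w where "w = v - c *\<^sub>R (r2 - r1)"
    have "mink r1 w = 0"
      using pos by (simp add: w_def c_def mink_expand null)
    moreover have "pencil L \<mu> (r2 - r1) x = 0" "pencil L \<mu> x (r2 - r1) = 0" for x
      using crit pencil_commute [OF sym, of \<mu> x] by (simp_all add: pencil_expand)
    then have "pencil L \<mu> w w = pencil L \<mu> v v"
      by (simp add: w_def pencil_expand)
    ultimately show ?thesis using snd [of w] by simp
  qed
  define p12 p13 p23 where "p12 = mink r1 r2" and "p13 = mink r1 r3" and "p23 = mink r2 r3"
  note p_pos = pos [folded p12_def p13_def p23_def]
  have mink_r: "mink r1 r2 = p12" "mink r2 r1 = p12" "mink r1 r3 = p13" "mink r3 r1 = p13"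
    "mink r2 r3 = p23" "mink r3 r2 = p23"
    by (simp_all add: p12_def p13_def p23_def mink_commute)
  \<comment> \<open>A rational parametrisation of the conic cut out of the cone by the plane through
    \<open>r1, r2, r3\<close>.\<close>
  define b where "b t = - t * p12 / (p13 + t * p23)" for t
  define \<gamma> where "\<gamma> t = (1 / (1 + t + b t)) *\<^sub>R (r1 + t *\<^sub>R r2 + b t *\<^sub>R r3)" for t
  have b: "(b \<longlongrightarrow> 0) (at_right 0)"
    unfolding b_def using p_pos by (auto intro!: tendsto_eq_intros)
  have lim: "(\<gamma> \<longlongrightarrow> r1) (at_right 0)"
    unfolding \<gamma>_def using b by (auto intro!: tendsto_eq_intros)
  have "((\<lambda>t. 1 + t + b t) \<longlongrightarrow> 1) (at_right 0)"
    using b by (auto intro!: tendsto_eq_intros)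
  from order_tendstoD(1) [OF this, of 0]
  have ev1: "\<forall>\<^sub>F t in at_right 0. 0 < 1 + t + b t" by simp
  \<comment> \<open>The sum is half the Minkowski square of
    \<open>r1 + t *\<^sub>R r2 + b t *\<^sub>R r3\<close>, and \<open>b\<close> is chosen to
    annihilate it. The sign of \<open>b t\<close> will show that the curve leaves
    \<open>r1\<close>.\<close>
  have ev2: "\<forall>\<^sub>F t in at_right 0. t * p12 + b t * p13 + t * b t * p23 = 0 \<and> b t < 0"
    using eventually_at_right_less [of 0]
  proof eventually_elim
    case (elim t)
    have "0 < p13 + t * p23" using elim p_pos by (simp add: add_pos_pos)
    then have "b t * (p13 + t * p23) = - t * p12" "b t < 0"
      using elim p_pos by (simp_all add: b_def divide_neg_pos)
    then show ?case by (simp add: algebra_simps)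
  qed
  have null_curve: "\<forall>\<^sub>F t in at_right 0. mink (\<gamma> t) (\<gamma> t) = 0"
    using ev2
  proof eventually_elim
    case (elim t)
    let ?s = "r1 + t *\<^sub>R r2 + b t *\<^sub>R r3"
    have "mink ?s ?s = 2 * (t * p12 + b t * p13 + t * b t * p23)"
      by (simp add: mink_expand mink_r null algebra_simps)
    with elim show ?case
      by (simp add: \<gamma>_def bilinear_lmul [OF bilinear_mink] bilinear_rmul [OF bilinear_mink])
  qed
  have min: "\<gamma>' \<in> local_minima (higgs_potential M L) LC_plus"
    if "\<gamma>' \<in> LC_plus" "mink \<gamma>' \<gamma>' = 0" "\<And>v. pencil L \<mu> \<gamma>' v = M \<bullet> v" for \<gamma>'
  proof (rule local_min_if_global [OF that(1)])
    fix s assume "s \<in> LC_plus"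
    then have "0 \<le> \<mu> * mink s s" using \<open>0 \<le> \<mu>\<close> by (simp add: mem_LC_plus_iff)
    with higgs_potential_diff [OF sym that(3), of s] psd [of "s - \<gamma>'"] that(2)
    show "higgs_potential M L \<gamma>' \<le> higgs_potential M L s" by simp
  qed
  show ?thesis
  proof (rule not_discrete_curve [OF _ lim])
    show "r1 \<in> local_minima (higgs_potential M L) LC_plus"
      using LC null crit by (intro min) auto
    show "\<forall>\<^sub>F t in at_right 0. \<gamma> t \<in> local_minima (higgs_potential M L) LC_plus"
      using ev1 null_curve order_tendstoD(1) [OF tendsto_vec_nth [OF lim] LC(2)]
    proof eventually_elim
      case (elim t)
      show ?case
      proof (rule min)
        show "\<gamma> t \<in> LC_plus" using elim by (simp add: mem_LC_plus_iff)
        show "pencil L \<mu> (\<gamma> t) v = M \<bullet> v" for v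
        proof -
          \<comment> \<open>The normalised coefficients sum to one, and the critical equation is
            affine in the point.\<close>
          have "pencil L \<mu> (\<gamma> t) v = (1 / (1 + t + b t)) * ((1 + t + b t) * (M \<bullet> v))"
            by (simp add: \<gamma>_def pencil_expand crit algebra_simps)
          with elim(1) show ?thesis by simp
        qed
      qed (fact elim)
    qed
    show "\<forall>\<^sub>F t in at_right 0. \<gamma> t \<noteq> r1"
      using ev1 ev2 eventually_at_right_less [of 0]
    proof eventually_elim
      case (elim t)
      \<comment> \<open>As \<open>r1\<close> is null, a nonzero product with \<open>r1\<close>
        separates the curve point from it.\<close>
      have "mink r1 (\<gamma> t) = (1 / (1 + t + b t)) * (t * p12 + b t * p13)"
        by (simp add: \<gamma>_def mink_expand mink_r null)
      moreover have "t * p12 + b t * p13 = - (t * b t * p23)"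
        using elim by linarith
      moreover have "t * b t * p23 \<noteq> 0" using elim p_pos by simp
      ultimately have "mink r1 (\<gamma> t) \<noteq> 0" using elim by simp
      with null show ?case by auto
    qed
  qed simp
qed

section \<open>Combination of the cases\<close>

theorem proposition1:
  fixes M :: "real ^ 4" and L :: "real ^ 4 ^ 4"
  assumes symmetric: "transpose L = L"
    and positive_definite: "\<And>r. r \<in> LC_plus - {0} \<Longrightarrow> quad_form L r > 0"
    and discrete_minima: "discrete (local_minima (higgs_potential M L) LC_plus)"
  shows "finite (local_minima (higgs_potential M L) LC_plus) \<and>
         card (local_minima (higgs_potential M L) LC_plus) \<le> 2"
proof (rule ccontr)
  let ?S = "local_minima (higgs_potential M L) LC_plus"
  assume "\<not> ?thesis"
  \<comment> \<open>Three minima can be chosen both from an infinite set and from a finite one with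
    more than two elements.\<close>
  then obtain T where T: "T \<subseteq> ?S" "card T = 3"
    using infinite_arbitrarily_large [of ?S 3] obtain_subset_with_card_n [of 3 ?S]
    by (metis not_less_eq_eq numeral_2_eq_2 numeral_3_eq_3)
  have min: "local_min_on (higgs_potential M L) LC_plus r" if "r \<in> T" for r
    using T(1) that by (auto simp: local_minima_def)
  note T_LC = local_min_mem [OF min]
  have M_pos: "0 < M \<bullet> r" if "r \<in> T" "r \<noteq> 0" for r
    using local_min_radial [OF symmetric min] T_LC positive_definite that by simp
  have not_single: "\<not> T \<subseteq> {r}" for r
    using T(2) card_mono [of "{r}" T] by auto
  have "0 \<notin> T"
  proof
    assume "0 \<in> T"
    from local_min_apex [OF symmetric min [OF this]] T_LC M_pos have "T \<subseteq> {0}"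
      by (metis insertCI linorder_not_less subsetI)
    with not_single show False by blast
  qed
  then have time: "0 < r $ 0" if "r \<in> T" for r
    using LC_plus_time_pos T_LC that by metis
  have null: "mink r r = 0" if "r \<in> T" for r
  proof (rule ccontr)
    assume "mink r r \<noteq> 0"
    then have "0 < mink r r" using T_LC [OF that] by (simp add: mem_LC_plus_iff)
    then have "T \<subseteq> {r}"
      using local_min_unique_if_interior [OF symmetric discrete_minima min [OF that] time [OF that]] min
      by blast
    with not_single show False by blast
  qed
  have M_T: "0 < M \<bullet> r" if "r \<in> T" for r
    using M_pos that \<open>0 \<notin> T\<close> by metis
  have pos: "0 < mink r s" if "r \<in> T" "s \<in> T" "r \<noteq> s" for r s
  proof (rule mink_pos)
    \<comment> \<open>Along a ray the radial condition equates a linear with a quadratic function of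
      the scale, both positive, so a ray carries at most one nonzero minimum.\<close>
    show "r $ 0 *\<^sub>R s \<noteq> s $ 0 *\<^sub>R r"
    proof
      assume eq: "r $ 0 *\<^sub>R s = s $ 0 *\<^sub>R r"
      define c where "c = s $ 0 / r $ 0"
      have "c *\<^sub>R r = (1 / r $ 0) *\<^sub>R (r $ 0 *\<^sub>R s)"
        unfolding eq by (simp add: c_def)
      then have s: "s = c *\<^sub>R r" using time [OF that(1)] by simp
      have "c > 0" using time that by (simp add: c_def)
      have "c * (M \<bullet> r) = c\<^sup>2 * quad_form L r"
        using local_min_radial [OF symmetric min [OF that(2)]]
        by (simp add: s quad_form_inner matrix_vector_mult_scaleR power2_eq_square)
      with local_min_radial [OF symmetric min [OF that(1)]] M_T [OF that(1)] \<open>c > 0\<close>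
      have "c = 1" by (simp add: power2_eq_square)
      with s that show False by simp
    qed
  qed (use that T_LC null in auto)
  have "\<forall>r\<in>T. \<exists>\<mu>. 0 \<le> \<mu> \<and> (\<forall>v. pencil L \<mu> r v = M \<bullet> v)
      \<and> (\<forall>w. mink r w = 0 \<longrightarrow> 0 \<le> pencil L \<mu> w w)"
    using local_min_boundary [OF symmetric min time null] by metis
  then obtain \<mu> where \<mu>: "\<And>r. r \<in> T \<Longrightarrow> 0 \<le> \<mu> r"
    and crit: "\<And>r v. r \<in> T \<Longrightarrow> pencil L (\<mu> r) r v = M \<bullet> v"
    and snd: "\<And>r w. r \<in> T \<Longrightarrow> mink r w = 0 \<Longrightarrow> 0 \<le> pencil L (\<mu> r) w w"
    by metis
  \<comment> \<open>Sorting \<open>T\<close> by the multiplier provides the order that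
    \<open>three_critical_points\<close> expects.\<close>
  obtain xs where xs: "set xs = T" "distinct xs"
    using T(2) finite_distinct_list card.infinite by (metis zero_neq_numeral)
  then have "length (sort_key \<mu> xs) = 3"
    using T(2) distinct_card by fastforce
  then obtain r1 r2 r3 where sorted: "sort_key \<mu> xs = [r1, r2, r3]"
    unfolding numeral_3_eq_3 length_Suc_conv by blast
  have r_in: "r1 \<in> T" "r2 \<in> T" "r3 \<in> T"
    using set_sort [of \<mu> xs] xs(1) unfolding sorted by auto
  have neq: "r1 \<noteq> r2" "r2 \<noteq> r3" "r1 \<noteq> r3"
    using distinct_sort [of \<mu> xs] xs(2) unfolding sorted by auto
  have order: "\<mu> r1 \<le> \<mu> r2" "\<mu> r2 \<le> \<mu> r3"
    using sorted_sort_key [of \<mu> xs] unfolding sorted by auto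
  have "\<mu> r1 = \<mu> r3"
  proof (rule three_critical_points)
    show "bilinear (pencil L 0)" "bilinear mink" by (rule bilinear_pencil bilinear_mink)+
    show "linear (\<lambda>v. M \<bullet> v)" by (simp add: bounded_linear.linear bounded_linear_inner_right)
    show "pencil L 0 r1 v - \<mu> r1 * mink r1 v = M \<bullet> v" "pencil L 0 r2 v - \<mu> r2 * mink r2 v = M \<bullet> v"
      "pencil L 0 r3 v - \<mu> r3 * mink r3 v = M \<bullet> v" for v
      using crit r_in by (auto simp: pencil_def)
    show "0 \<le> pencil L 0 w w - \<mu> r1 * mink w w" if "mink r1 w = 0" for w
      using snd [OF r_in(1) that] by (simp add: pencil_def)
    show "0 \<le> pencil L 0 w w - \<mu> r2 * mink w w" if "mink r2 w = 0" for w
      using snd [OF r_in(2) that] by (simp add: pencil_def)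
  qed (fact pencil_commute [OF symmetric] mink_commute order
      | rule null pos M_T r_in neq)+
  with order have "\<mu> r2 = \<mu> r1" "\<mu> r3 = \<mu> r1" by auto
  then have crit': "pencil L (\<mu> r1) r2 v = M \<bullet> v" "pencil L (\<mu> r1) r3 v = M \<bullet> v" for v
    using crit [OF r_in(2), of v] crit [OF r_in(3), of v] by simp_all
  from three_equal_multipliers_not_discrete [OF symmetric \<mu> [OF r_in(1)]
      T_LC [OF r_in(1)] time [OF r_in(1)] r_in(1-3) [THEN null]
      pos [OF r_in(1,2) neq(1)] pos [OF r_in(1,3) neq(3)] pos [OF r_in(2,3) neq(2)]
      crit [OF r_in(1)] crit' snd [OF r_in(1)]]
  show False using discrete_minima by blast
qed

end
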